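(* Let $G$ be an ADMG with vertex set $V$, let $\prec$ be an ordering of $V$ consistent with $G$, let $x \in V$, and let $P$ be a joint probability distribution of random variables indexed by $V$. Assume that for all $y \in \mathrm{pre}_{G,\prec}(x) \setminus \{x\}$ and every maximal ancestral set $S$ such that $y \in S \subseteq \mathrm{pre}_{G,\prec}(y)$, the relation $I(\{y\}, \mathrm{mb}(y,S), S \setminus (\mathrm{mb}(y,S) \cup \{y\}))$ holds in $P$. Let $A = \mathrm{pre}_{G,\prec}(x)$ and let $A'$ be a maximal ancestral set such that $x \in A' \subseteq \mathrm{pre}_{G,\prec}(x)$. Let $$Y = \mathrm{dis}_{G_A}(x) \setminus \mathrm{dis}_{G_{A'}}(x), \quad Y_1 = \mathrm{dis}_{G_A}(x) \setminus (A' \cap \mathrm{dis}_{G_A}(x)), \quad Y_2 = Y \setminus Y_1.$$ If $Y_2 = \emptyset$ and $\mathrm{pa}_G(Y) \subseteq \mathrm{mb}(x,A')$, then $$I(\{x\}, \mathrm{mb}(x,A), A \setminus (\mathrm{mb}(x,A) \cup \{x\}))$$ implies $$I(\{x\}, \mathrm{mb}(x,A'), A' \setminus (\mathrm{mb}(x,A') \cup \{x\}))$$ (both relations being understood in $P$).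
   Context: An acyclic directed mixed graph (ADMG) $G$ is a finite graph whose edges are directed ($\to$) or bi-directed ($\leftrightarrow$) and which has no directed cycle (consisting of $\to$ edges); a pair of vertices may be joined by both a directed and a bi-directed edge. For a vertex $x$: $\mathrm{pa}_G(x) = \{v : v \to x \text{ in } G\}$ (parents); $\mathrm{an}_G(x) = \{v : v \to \cdots \to x \text{ in } G \text{ or } v = x\}$ (ancestors); $\mathrm{dis}_G(x) = \{v : v \leftrightarrow \cdots \leftrightarrow x \text{ in } G \text{ or } v = x\}$ (district). Parents and ancestors are extended to sets of vertices by unions, e.g. $\mathrm{pa}_G(Y) = \bigcup_{y \in Y} \mathrm{pa}_G(y)$. A (strict total) ordering $\prec$ on $V$ is consistent with $G$ if $x \prec y \Rightarrow y \notin \mathrm{an}_G(x)$. Put $\mathrm{pre}_{G,\prec}(x) = \{v : v \prec x \text{ or } v = x\}$. A set $A \subseteq V$ is ancestral if $\mathrm{an}_G(A) = A$. $G_A$ is the induced subgraph of $G$ on $A$. If $A$ is ancestral and $x \in A$ has no children in $A$, the Markov blanket of $x$ with respect to the induced subgraph on $A$ is $\mathrm{mb}(x,A) = \mathrm{pa}_{G_A}(\mathrm{dis}_{G_A}(x)) \cup (\mathrm{dis}_{G_A}(x) \setminus \{x\})$. An ancestral set $A$ with $x \in A \subseteq \mathrm{pre}_{G,\prec}(x)$ is maximal (with respect to the Markov blanket $\mathrm{mb}(x,A)$) if, whenever $B$ is an ancestral set with $A \subseteq B \subseteq \mathrm{pre}_{G,\prec}(x)$ and $\mathrm{mb}(x,A)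 = \mathrm{mb}(x,B)$, then $A = B$. (For ancestral sets $S$ with $y \in S \subseteq \mathrm{pre}_{G,\prec}(y)$, maximality is meant in the same sense with $y$ in place of $x$.) For disjoint $X,Y,Z \subseteq V$, $I(X,Z,Y)$ denotes that $X$ is conditionally independent of $Y$ given $Z$ (trivially true if $X$ or $Y$ is empty). The composition axiom is not assumed for $P$. *)

theory Defs
  imports "HOL-Probability.Probability"
begin

section \<open>Acyclic directed mixed graphs\<close>

text \<open>
  A pair \<open>(v, w) \<in> dir G\<close> is the edge \<open>v \<rightarrow> w\<close>; a bi-directed edge \<open>v \<leftrightarrow> w\<close> is represented
  by both \<open>(v, w)\<close> and \<open>(w, v)\<close> in \<open>bidir G\<close>.
\<close>

record 'a mixed_graph =
  verts :: "'a set"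
  dir :: "('a \<times> 'a) set"
  bidir :: "('a \<times> 'a) set"

text \<open>
  Loops \<open>v \<leftrightarrow> v\<close> are not excluded: they affect none of the notions below.
\<close>

definition admg :: "'a mixed_graph \<Rightarrow> bool" where
  "admg G \<longleftrightarrow> finite (verts G) \<and>
     dir G \<subseteq> verts G \<times> verts G \<and> acyclic (dir G) \<and>
     bidir G \<subseteq> verts G \<times> verts G \<and> sym (bidir G)"

definition pa :: "'a mixed_graph \<Rightarrow> 'a \<Rightarrow> 'a set" where
  "pa G x = {v. (v, x) \<in> dir G}"

definition pa_set :: "'a mixed_graph \<Rightarrow> 'a set \<Rightarrow> 'a set" where
  "pa_set G Y = (\<Union>y\<in>Y. pa G y)"

definition an :: "'a mixed_graph \<Rightarrow> 'a \<Rightarrow> 'a set" where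
  "an G x = {v. (v, x) \<in> (dir G)\<^sup>*}"

definition an_set :: "'a mixed_graph \<Rightarrow> 'a set \<Rightarrow> 'a set" where
  "an_set G Y = (\<Union>y\<in>Y. an G y)"

definition dis :: "'a mixed_graph \<Rightarrow> 'a \<Rightarrow> 'a set" where
  "dis G x = {v. (v, x) \<in> (bidir G)\<^sup>*}"

definition induced :: "'a mixed_graph \<Rightarrow> 'a set \<Rightarrow> 'a mixed_graph" where
  "induced G A = \<lparr>verts = verts G \<inter> A, dir = dir G \<inter> A \<times> A, bidir = bidir G \<inter> A \<times> A\<rparr>"

definition ancestral :: "'a mixed_graph \<Rightarrow> 'a set \<Rightarrow> bool" where
  "ancestral G A \<longleftrightarrow> A \<subseteq> verts G \<and> an_set G A = A"

definition consistent_ordering :: "'a mixed_graph \<Rightarrow> ('a \<times> 'a) set \<Rightarrow> bool" where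
  "consistent_ordering G r \<longleftrightarrow>
     r \<subseteq> verts G \<times> verts G \<and> strict_linear_order_on (verts G) r \<and>
     (\<forall>x y. (x, y) \<in> r \<longrightarrow> y \<notin> an G x)"

definition pre :: "('a \<times> 'a) set \<Rightarrow> 'a \<Rightarrow> 'a set" where
  "pre r x = {v. (v, x) \<in> r \<or> v = x}"

text \<open>
  The Markov blanket is meant for ancestral \<open>A\<close> in which \<open>x \<in> A\<close> has no children; this holds
  for every ancestral \<open>A\<close> with \<open>x \<in> A \<subseteq> pre r x\<close> when \<open>r\<close> is consistent with \<open>G\<close>.
\<close>

definition mb :: "'a mixed_graph \<Rightarrow> 'a \<Rightarrow> 'a set \<Rightarrow> 'a set" where
  "mb G x A = pa_set (induced G A) (dis (induced G A) x) \<union> (dis (induced G A) x - {x})"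

definition maximal_ancestral ::
    "'a mixed_graph \<Rightarrow> ('a \<times> 'a) set \<Rightarrow> 'a \<Rightarrow> 'a set \<Rightarrow> bool" where
  "maximal_ancestral G r x A \<longleftrightarrow>
     ancestral G A \<and> x \<in> A \<and> A \<subseteq> pre r x \<and>
     (\<forall>B. ancestral G B \<and> A \<subseteq> B \<and> B \<subseteq> pre r x \<and> mb G x A = mb G x B \<longrightarrow> A = B)"

section \<open>Conditional independence\<close>

text \<open>
  The sigma-algebra generated by the coordinates with index in \<open>A\<close>. For a joint distribution
  \<open>P\<close> on the product of the state spaces \<open>M v\<close>, the random variables are the coordinate maps.
\<close>

definition coord_algebra ::
    "('a \<Rightarrow> 'b) measure \<Rightarrow> ('a \<Rightarrow> 'b measure) \<Rightarrow> 'a set \<Rightarrow> ('a \<Rightarrow> 'b) measure" where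
  "coord_algebra P M A = vimage_algebra (space P) (\<lambda>\<omega>. restrict \<omega> A) (Pi\<^sub>M A M)"

lemma subalgebra_coord_algebra:
  assumes "sets P = sets (Pi\<^sub>M V M)" "A \<subseteq> V"
  shows "subalgebra P (coord_algebra P M A)"
proof -
  have "(\<lambda>\<omega>. restrict \<omega> A) \<in> measurable P (Pi\<^sub>M A M)"
    using measurable_restrict_subset[OF assms(2), of M] measurable_cong_sets[OF assms(1) refl]
    by blast
  then show ?thesis
    unfolding subalgebra_def coord_algebra_def
    by (simp add: measurable_iff_sets space_vimage_algebra)
qed

text \<open>
  \<open>cond_indep P M X Z Y\<close>: the variables in \<open>X\<close> are independent of those in \<open>Y\<close> given those in
  \<open>Z\<close>, that is, \<open>P(E \<inter> F | Z) = P(E | Z) P(F | Z)\<close> almost surely for all events \<open>E\<close>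
  determined by \<open>X\<close> and \<open>F\<close> determined by \<open>Y\<close>.
\<close>

definition cond_indep ::
    "('a \<Rightarrow> 'b) measure \<Rightarrow> ('a \<Rightarrow> 'b measure) \<Rightarrow> 'a set \<Rightarrow> 'a set \<Rightarrow> 'a set \<Rightarrow> bool" where
  "cond_indep P M X Z Y \<longleftrightarrow>
     (\<forall>E \<in> sets (coord_algebra P M X). \<forall>F \<in> sets (coord_algebra P M Y).
        AE \<omega> in P. real_cond_exp P (coord_algebra P M Z) (indicator (E \<inter> F)) \<omega> =
          real_cond_exp P (coord_algebra P M Z) (indicator E) \<omega> *
          real_cond_exp P (coord_algebra P M Z) (indicator F) \<omega>)"

end

theory Submission
  imports Defs
begin

text \<open>
  Write \<open>B = mb(x, A')\<close> and \<open>C = A' \ (B \<union> {x})\<close>. The hypotheses give \<open>Y \<inter> A' = {}\<close> and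
  \<open>mb(x, A) = B \<union> Y\<close>, so \<open>I({x}, B \<union> Y, C)\<close> holds by decomposition, and by contraction it suffices
  to show \<open>I(Y, B, C)\<close>. This is a separation statement in the graph induced on the ancestral set
  \<open>Y \<union> (A' \ {x})\<close>, whose members all precede \<open>x\<close>: no district together with its parents meets
  both \<open>Y\<close> and \<open>C\<close>. Such statements follow from the ordered local Markov property by induction
  on the ancestral set, removing its last vertex.
\<close>

section \<open>Conditional independence as a semigraphoid\<close>

text \<open>\<open>K\<close> is the join of \<open>G\<close> and \<open>H\<close>, so the right-hand
  side says that learning \<open>H\<close> on top of \<open>G\<close> does not change the prediction
  of \<open>E\<close>. From right to left this is the tower property through \<open>K\<close>. From
  left to right the conditional expectation given \<open>G\<close> is shown to have the right
  integrals over a \<pi>-system generating \<open>K\<close>.\<close>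

lemma (in prob_space) real_cond_exp_join_iff:
  assumes G: "subalgebra M G" and H: "subalgebra M H" and K: "subalgebra M K"
    and sets_K: "sets K = sigma_sets (space M) {A \<inter> B |A B. A \<in> sets H \<and> B \<in> sets G}"
    and E: "E \<in> sets M"
  shows "(\<forall>A\<in>sets H. AE \<omega> in M. real_cond_exp M G (indicator (E \<inter> A)) \<omega> =
            real_cond_exp M G (indicator E) \<omega> * real_cond_exp M G (indicator A) \<omega>) \<longleftrightarrow>
         (AE \<omega> in M. real_cond_exp M K (indicator E) \<omega> = real_cond_exp M G (indicator E) \<omega>)"
    (is "?indep \<longleftrightarrow> ?eq")
proof -
  interpret G: finite_measure_subalgebra M G by standard (rule G)
  interpret K: finite_measure_subalgebra M K by standard (rule K)
  let ?g = "real_cond_exp M G (indicator E)"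
  have sp: "space G = space M" "space H = space M" "space K = space M"
    using G H K by (auto simp: subalgebra_def)
  have GM: "B \<in> sets M" if "B \<in> sets G" for B using G that by (auto simp: subalgebra_def)
  have HM: "B \<in> sets M" if "B \<in> sets H" for B using H that by (auto simp: subalgebra_def)
  have KM: "B \<in> sets M" if "B \<in> sets K" for B using K that by (auto simp: subalgebra_def)
  have GK: "subalgebra K G"
  proof -
    have "B \<in> sets K" if "B \<in> sets G" for B
    proof -
      have "B = space M \<inter> B" using sets.sets_into_space[OF that] sp by auto
      then show ?thesis unfolding sets_K using that sets.top[of H] sp by (auto intro!: sigma_sets.Basic)
    qed
    then show ?thesis by (auto simp: subalgebra_def sp)
  qed
  have HK: "B \<in> sets K" if "B \<in> sets H" for B
  proof -
    have "B = B \<inter> space M" using sets.sets_into_space[OF that] sp by auto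
    then show ?thesis unfolding sets_K using that sets.top[of G] sp by (auto intro!: sigma_sets.Basic)
  qed
  have E_int: "integrable M (indicator E :: _ \<Rightarrow> real)"
    using E by (intro integrable_real_indicator) (auto simp: less_top[symmetric])
  have g_int: "integrable M ?g" using E_int by (rule G.real_cond_exp_int(1))
  have int_ind: "integrable M (\<lambda>\<omega>. indicator A \<omega> * f \<omega>)"
    if "A \<in> sets M" "integrable M f" for A and f :: "'a \<Rightarrow> real"
    using integrable_mult_indicator[OF that] by simp
  show ?thesis
  proof
    assume eq: ?eq
    show ?indep
    proof
      fix A assume A: "A \<in> sets H"
      note [measurable] = HM[OF A] HK[OF A] E
      have IA: "integrable M (\<lambda>\<omega>. indicator A \<omega> * indicator E \<omega> :: real)"
        using int_ind[OF HM[OF A] E_int] .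
      have IA': "indicator (E \<inter> A) = (\<lambda>\<omega>. indicator A \<omega> * indicator E \<omega> :: real)"
        by (auto simp: indicator_def)
      \<comment> \<open>Condition on \<open>K\<close> first: the factor \<open>indicator A\<close>
        is \<open>K\<close>-measurable and comes out, and what remains is \<open>?g\<close> by
        assumption. In the outer conditioning on \<open>G\<close> it is then \<open>?g\<close> that
        comes out.\<close>
      have 1: "AE \<omega> in M. real_cond_exp M G (indicator (E \<inter> A)) \<omega> =
          real_cond_exp M G (real_cond_exp M K (indicator (E \<inter> A))) \<omega>"
        using G.real_cond_exp_nested_subalg[OF K GK, of "indicator (E \<inter> A)"] IA IA' by auto
      have "AE \<omega> in M. real_cond_exp M K (\<lambda>\<omega>. indicator A \<omega> * indicator E \<omega>) \<omega> =
          indicator A \<omega> * real_cond_exp M K (indicator E) \<omega>"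
        by (rule K.real_cond_exp_mult) (use IA in auto)
      then have "AE \<omega> in M. real_cond_exp M K (indicator (E \<inter> A)) \<omega> = ?g \<omega> * indicator A \<omega>"
        using eq unfolding IA' by eventually_elim auto
      then have 2: "AE \<omega> in M. real_cond_exp M G (real_cond_exp M K (indicator (E \<inter> A))) \<omega>
          = real_cond_exp M G (\<lambda>\<omega>. ?g \<omega> * indicator A \<omega>) \<omega>"
        by (rule G.real_cond_exp_cong) auto
      have 3: "AE \<omega> in M. real_cond_exp M G (\<lambda>\<omega>. ?g \<omega> * indicator A \<omega>) \<omega> =
          ?g \<omega> * real_cond_exp M G (indicator A) \<omega>"
        by (rule G.real_cond_exp_mult) (use int_ind[OF HM[OF A] g_int] in \<open>auto simp: mult.commute\<close>)
      from 1 2 3 show "AE \<omega> in M. real_cond_exp M G (indicator (E \<inter> A)) \<omega> =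
          ?g \<omega> * real_cond_exp M G (indicator A) \<omega>"
        by eventually_elim auto
    qed
  next
    assume indep: ?indep
    \<comment> \<open>On a generator \<open>A \<inter> B\<close>, shift \<open>indicator A\<close>
      into the integrand, condition on \<open>G\<close> over \<open>B\<close>, factorise by the
      assumption, and undo the first two moves with \<open>?g\<close> in place of
      \<open>indicator E\<close>.\<close>
    have base: "(LINT \<omega>:A \<inter> B|M. indicator E \<omega>) = (LINT \<omega>:A \<inter> B|M. ?g \<omega>)"
      if A: "A \<in> sets H" and B: "B \<in> sets G" for A B
    proof -
      note [measurable] = HM[OF A] GM[OF B] E B
      have IA: "integrable M (indicator (E \<inter> A) :: _ \<Rightarrow> real)"
        by (intro integrable_real_indicator) (auto simp: less_top[symmetric])
      have gA: "integrable M (\<lambda>\<omega>. ?g \<omega> * indicator A \<omega>)"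
        using int_ind[OF HM[OF A] g_int] by (simp add: mult.commute)
      have "(LINT \<omega>:A \<inter> B|M. indicator E \<omega>) = (LINT \<omega>:B|M. indicator (E \<inter> A) \<omega> :: real)"
        unfolding set_lebesgue_integral_def
        by (rule Bochner_Integration.integral_cong) (auto simp: indicator_def)
      also have "\<dots> = (LINT \<omega>:B|M. real_cond_exp M G (indicator (E \<inter> A)) \<omega>)"
        by (rule G.real_cond_exp_intA[OF IA B])
      also have "\<dots> = (LINT \<omega>:B|M. ?g \<omega> * real_cond_exp M G (indicator A) \<omega>)"
        by (rule set_lebesgue_integral_cong_AE) (use indep A in auto)
      also have "\<dots> = (LINT \<omega>:B|M. real_cond_exp M G (\<lambda>\<omega>. ?g \<omega> * indicator A \<omega>) \<omega>)"
      proof (rule set_lebesgue_integral_cong_AE)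
        have "AE \<omega> in M. real_cond_exp M G (\<lambda>\<omega>. ?g \<omega> * indicator A \<omega>) \<omega> =
            ?g \<omega> * real_cond_exp M G (indicator A) \<omega>"
          by (rule G.real_cond_exp_mult) (use gA in auto)
        then show "AE \<omega>\<in>B in M. ?g \<omega> * real_cond_exp M G (indicator A) \<omega> =
            real_cond_exp M G (\<lambda>\<omega>. ?g \<omega> * indicator A \<omega>) \<omega>"
          by eventually_elim auto
      qed auto
      also have "\<dots> = (LINT \<omega>:B|M. ?g \<omega> * indicator A \<omega>)"
        using G.real_cond_exp_intA[OF gA B] by simp
      also have "\<dots> = (LINT \<omega>:A \<inter> B|M. ?g \<omega>)"
        unfolding set_lebesgue_integral_def
        by (rule Bochner_Integration.integral_cong) (auto simp: indicator_def)
      finally show ?thesis .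
    qed
    \<comment> \<open>Dynkin's argument extends the equality of integrals from these generators to
      all of \<open>K\<close>. Since \<open>?g\<close> is \<open>K\<close>-measurable, it is then a
      version of the conditional expectation given \<open>K\<close>.\<close>
    let ?\<C> = "{A \<inter> B |A B. A \<in> sets H \<and> B \<in> sets G}"
    have "Int_stable ?\<C>"
    proof (rule Int_stableI)
      fix a b assume "a \<in> ?\<C>" and "b \<in> ?\<C>"
      then obtain A B A' B' where "a = A \<inter> B" "b = A' \<inter> B'"
        "A \<in> sets H" "B \<in> sets G" "A' \<in> sets H" "B' \<in> sets G" by blast
      then show "a \<inter> b \<in> ?\<C>"
        by (intro CollectI exI[of _ "A \<inter> A'"] exI[of _ "B \<inter> B'"]) auto
    qed
    moreover have "?\<C> \<subseteq> Pow (space M)"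
      using sets.sets_into_space[of _ G] sp by auto
    ultimately have "(LINT \<omega>:C|M. indicator E \<omega>) = (LINT \<omega>:C|M. ?g \<omega>)" if "C \<in> sets K" for C
      using that[unfolded sets_K]
    proof (induction rule: sigma_sets_induct_disjoint)
      case (basic C)
      then show ?case using base by auto
    next
      case empty
      then show ?case by (simp add: set_lebesgue_integral_def)
    next
      case (compl C)
      then have C: "C \<in> sets M" using KM sets_K by auto
      have split: "(LINT \<omega>:space M - C|M. f \<omega>) = (LINT \<omega>|M. f \<omega>) - (LINT \<omega>:C|M. f \<omega>)"
        if "integrable M f" for f :: "'a \<Rightarrow> real"
      proof -
        have "(LINT \<omega>:space M - C|M. f \<omega>) = (LINT \<omega>|M. f \<omega> - indicator C \<omega> * f \<omega>)"
          unfolding set_lebesgue_integral_def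
          by (rule Bochner_Integration.integral_cong) (auto simp: indicator_def)
        also have "\<dots> = (LINT \<omega>|M. f \<omega>) - (LINT \<omega>:C|M. f \<omega>)"
          unfolding set_lebesgue_integral_def
          using int_ind[OF C that] that by (subst Bochner_Integration.integral_diff) auto
        finally show ?thesis .
      qed
      show ?case
        using split[OF E_int] split[OF g_int] compl.IH G.real_cond_exp_int(2)[OF E_int] by simp
    next
      case (union C)
      then have C: "C i \<in> sets M" for i using KM sets_K by auto
      have "(LINT \<omega>:(\<Union>i. C i)|M. f \<omega>) = (\<Sum>i. LINT \<omega>:C i|M. f \<omega>)"
        if "integrable M f" for f :: "'a \<Rightarrow> real"
        using union.hyps(1) C that integrable_mult_indicator[of "\<Union>i. C i" M f]
        by (intro lebesgue_integral_countable_add)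
           (auto simp: disjoint_family_on_def set_integrable_def)
      from this[OF E_int] this[OF g_int] show ?case using union.IH by simp
    qed
    then show ?eq
      using E_int g_int measurable_from_subalg[OF GK borel_measurable_cond_exp]
      by (intro K.real_cond_exp_charact) auto
  qed
qed

section \<open>Sigma-algebras generated by sets of coordinates\<close>

lemma space_coord_algebra [simp]: "space (coord_algebra P M A) = space P"
  by (simp add: coord_algebra_def)

locale coordinate_process = prob_space P for P :: "('a \<Rightarrow> 'b) measure" +
  fixes V :: "'a set" and M :: "'a \<Rightarrow> 'b measure"
  assumes sets_P: "sets P = sets (Pi\<^sub>M V M)"
begin

abbreviation coords :: "'a set \<Rightarrow> ('a \<Rightarrow> 'b) measure" where
  "coords A \<equiv> coord_algebra P M A"

abbreviation indep_given :: "'a set \<Rightarrow> 'a set \<Rightarrow> 'a set \<Rightarrow> bool" where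
  "indep_given X Z Y \<equiv> cond_indep P M X Z Y"

lemma subalgebra_coords: "A \<subseteq> V \<Longrightarrow> subalgebra P (coords A)"
  by (rule subalgebra_coord_algebra[OF sets_P])

lemma component_in_space: "A \<subseteq> V \<Longrightarrow> (\<lambda>\<omega>. restrict \<omega> A) \<in> space P \<rightarrow> space (Pi\<^sub>M A M)"
  using sets_eq_imp_space_eq[OF sets_P] by (auto simp: space_PiM PiE_def Pi_iff)

lemma measurable_component_coords:
  assumes "A \<subseteq> V" "i \<in> A"
  shows "(\<lambda>\<omega>. \<omega> i) \<in> coords A \<rightarrow>\<^sub>M M i"
proof -
  have "(\<lambda>\<omega>. restrict \<omega> A) \<in> coords A \<rightarrow>\<^sub>M Pi\<^sub>M A M"
    unfolding coord_algebra_def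
    by (rule measurable_vimage_algebra1[OF component_in_space[OF assms(1)]])
  from measurable_compose[OF this measurable_component_singleton[OF assms(2)]]
  show ?thesis using assms(2) by simp
qed

text \<open>Reduces inclusions between sigma-algebras to measurability of single coordinates;
  monotonicity and the description of joins both rest on it.\<close>

lemma sets_coords_least:
  assumes "space N = space P" and "\<And>i. i \<in> A \<Longrightarrow> (\<lambda>\<omega>. \<omega> i) \<in> N \<rightarrow>\<^sub>M M i"
  shows "sets (coords A) \<subseteq> sets N"
  unfolding coord_algebra_def
  by (rule sets_image_in_sets[OF assms(1)]) (auto intro: measurable_restrict assms(2))

lemma sets_coords_mono:
  assumes "A \<subseteq> B" "B \<subseteq> V"
  shows "sets (coords A) \<subseteq> sets (coords B)"
  using assms by (intro sets_coords_least measurable_component_coords) auto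

text \<open>The generators are written with the events of \<open>B\<close> first so that the
  equation matches the premise \<open>sets_K\<close> of \<open>real_cond_exp_join_iff\<close>, with
  \<open>coords A\<close> in the role of \<open>G\<close>.\<close>

lemma sets_coords_Un:
  assumes "A \<subseteq> V" "B \<subseteq> V"
  shows "sets (coords (A \<union> B)) =
    sigma_sets (space P) {a \<inter> b |a b. a \<in> sets (coords B) \<and> b \<in> sets (coords A)}"
    (is "_ = sigma_sets _ ?\<C>")
proof
  have \<C>: "?\<C> \<subseteq> Pow (space P)"
    using sets.sets_into_space[of _ "coords A"] by auto
  let ?N = "sigma (space P) ?\<C>"
  have A: "a \<in> sets ?N" if "a \<in> sets (coords A)" for a
  proof -
    have "a = space P \<inter> a" using sets.sets_into_space[OF that] by auto
    then show ?thesis using \<C> that sets.top[of "coords B"] by (auto intro!: sigma_sets.Basic)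
  qed
  have B: "a \<in> sets ?N" if "a \<in> sets (coords B)" for a
  proof -
    have "a = a \<inter> space P" using sets.sets_into_space[OF that] by auto
    then show ?thesis using \<C> that sets.top[of "coords A"] by (auto intro!: sigma_sets.Basic)
  qed
  have "sets (coords (A \<union> B)) \<subseteq> sets ?N"
  proof (rule sets_coords_least)
    fix i assume "i \<in> A \<union> B"
    then show "(\<lambda>\<omega>. \<omega> i) \<in> ?N \<rightarrow>\<^sub>M M i"
    proof
      assume "i \<in> A"
      show ?thesis
        by (rule measurable_from_subalg[OF _ measurable_component_coords[OF assms(1) \<open>i \<in> A\<close>]])
           (use A \<C> in \<open>auto simp: subalgebra_def\<close>)
    next
      assume "i \<in> B"
      show ?thesis
        by (rule measurable_from_subalg[OF _ measurable_component_coords[OF assms(2) \<open>i \<in> B\<close>]])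
           (use B \<C> in \<open>auto simp: subalgebra_def\<close>)
    qed
  qed (use \<C> in simp)
  then show "sets (coords (A \<union> B)) \<subseteq> sigma_sets (space P) ?\<C>" using \<C> by simp
  have "?\<C> \<subseteq> sets (coords (A \<union> B))"
    using sets_coords_mono[of A "A \<union> B"] sets_coords_mono[of B "A \<union> B"] assms by auto
  from sets.sigma_sets_subset[OF this]
  show "sigma_sets (space P) ?\<C> \<subseteq> sets (coords (A \<union> B))" by simp
qed

text \<open>The product form of the definition makes symmetry and decomposition immediate. This
  asymmetric form turns weak union and contraction into chains of almost sure equalities.\<close>

lemma cond_indep_iff:
  assumes "X \<subseteq> V" "Y \<subseteq> V" "Z \<subseteq> V"
  shows "indep_given X Z Y \<longleftrightarrow> (\<forall>E\<in>sets (coords X). AE \<omega> in P.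
    real_cond_exp P (coords (Z \<union> Y)) (indicator E) \<omega> = real_cond_exp P (coords Z) (indicator E) \<omega>)"
  unfolding cond_indep_def
proof (rule ball_cong[OF refl])
  fix E assume "E \<in> sets (coords X)"
  then have "E \<in> sets P" using subalgebra_coords[OF assms(1)] by (auto simp: subalgebra_def)
  then show "(\<forall>A\<in>sets (coords Y). AE \<omega> in P. real_cond_exp P (coords Z) (indicator (E \<inter> A)) \<omega> =
        real_cond_exp P (coords Z) (indicator E) \<omega> * real_cond_exp P (coords Z) (indicator A) \<omega>) \<longleftrightarrow>
    (AE \<omega> in P. real_cond_exp P (coords (Z \<union> Y)) (indicator E) \<omega> =
        real_cond_exp P (coords Z) (indicator E) \<omega>)"
    using assms by (intro real_cond_exp_join_iff subalgebra_coords sets_coords_Un) auto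
qed

section \<open>Semigraphoid axioms\<close>

lemma cond_indep_sym: "indep_given X Z Y \<Longrightarrow> indep_given Y Z X"
  unfolding cond_indep_def by (subst Int_commute, subst mult.commute) blast

lemma cond_indep_mono:
  assumes "indep_given X Z Y" "X' \<subseteq> X" "X \<subseteq> V" "Y' \<subseteq> Y" "Y \<subseteq> V"
  shows "indep_given X' Z Y'"
  using assms sets_coords_mono[OF assms(2,3)] sets_coords_mono[OF assms(4,5)]
  unfolding cond_indep_def by blast

text \<open>Conditioning on \<open>Z \<union> Y \<union> W\<close> and on
  \<open>Z \<union> W\<close> both give the same as conditioning on \<open>Z\<close>, the latter by
  decomposition; hence they agree with each other.\<close>

lemma cond_indep_weak_union:
  assumes I: "indep_given X Z (Y \<union> W)" and V: "X \<subseteq> V" "Y \<subseteq> V" "Z \<subseteq> V" "W \<subseteq> V"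
  shows "indep_given X (Z \<union> W) Y"
proof -
  have IW: "indep_given X Z W" using V by (intro cond_indep_mono[OF I]) auto
  show ?thesis
    unfolding cond_indep_iff[OF V(1,2) Un_least[OF V(3,4)]]
  proof
    fix E assume E: "E \<in> sets (coords X)"
    have "AE \<omega> in P. real_cond_exp P (coords (Z \<union> (Y \<union> W))) (indicator E) \<omega> =
        real_cond_exp P (coords Z) (indicator E) \<omega>"
      using I V E by (simp add: cond_indep_iff)
    moreover have "AE \<omega> in P. real_cond_exp P (coords (Z \<union> W)) (indicator E) \<omega> =
        real_cond_exp P (coords Z) (indicator E) \<omega>"
      using IW V E by (simp add: cond_indep_iff)
    moreover have "Z \<union> (Y \<union> W) = Z \<union> W \<union> Y" by blast
    ultimately show "AE \<omega> in P. real_cond_exp P (coords (Z \<union> W \<union> Y)) (indicator E) \<omega> =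
        real_cond_exp P (coords (Z \<union> W)) (indicator E) \<omega>"
      by auto
  qed
qed

lemma cond_indep_contraction:
  assumes I: "indep_given X Z Y" "indep_given X (Z \<union> Y) W"
    and V: "X \<subseteq> V" "Y \<subseteq> V" "Z \<subseteq> V" "W \<subseteq> V"
  shows "indep_given X Z (Y \<union> W)"
  unfolding cond_indep_iff[OF V(1) Un_least[OF V(2,4)] V(3)]
proof
  fix E assume E: "E \<in> sets (coords X)"
  have "AE \<omega> in P. real_cond_exp P (coords (Z \<union> Y)) (indicator E) \<omega> =
      real_cond_exp P (coords Z) (indicator E) \<omega>"
    using I(1) V E by (simp add: cond_indep_iff)
  moreover have "AE \<omega> in P. real_cond_exp P (coords (Z \<union> Y \<union> W)) (indicator E) \<omega> =
      real_cond_exp P (coords (Z \<union> Y)) (indicator E) \<omega>"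
    using I(2) V E by (simp add: cond_indep_iff)
  ultimately show "AE \<omega> in P. real_cond_exp P (coords (Z \<union> (Y \<union> W))) (indicator E) \<omega> =
      real_cond_exp P (coords Z) (indicator E) \<omega>"
    by (auto simp: Un_assoc)
qed

end

section \<open>Districts and ancestral sets\<close>

text \<open>Closure under single edges extends to ancestors by induction along a directed
  path.\<close>

lemma ancestral_iff:
  "ancestral G A \<longleftrightarrow> A \<subseteq> verts G \<and> (\<forall>v w. (v, w) \<in> dir G \<longrightarrow> w \<in> A \<longrightarrow> v \<in> A)"
proof -
  have "an_set G A = A \<longleftrightarrow> (\<forall>v w. (v, w) \<in> dir G \<longrightarrow> w \<in> A \<longrightarrow> v \<in> A)"
  proof
    assume "an_set G A = A"
    then show "\<forall>v w. (v, w) \<in> dir G \<longrightarrow> w \<in> A \<longrightarrow> v \<in> A"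
      unfolding an_set_def an_def by blast
  next
    assume closed: "\<forall>v w. (v, w) \<in> dir G \<longrightarrow> w \<in> A \<longrightarrow> v \<in> A"
    have "v \<in> A" if "(v, w) \<in> (dir G)\<^sup>*" "w \<in> A" for v w
      using that by (induction rule: converse_rtrancl_induct) (use closed in blast)+
    then show "an_set G A = A" unfolding an_set_def an_def by blast
  qed
  then show ?thesis by (auto simp: ancestral_def)
qed

lemma dis_refl [simp]: "x \<in> dis G x"
  by (simp add: dis_def)

lemma dis_eq:
  assumes "sym (bidir G)" "v \<in> dis G w"
  shows "dis G v = dis G w"
proof -
  have "(w, v) \<in> (bidir G)\<^sup>*"
    using assms sym_rtrancl[OF assms(1)] by (auto simp: dis_def dest: symD)
  with assms(2) show ?thesis by (auto simp: dis_def)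
qed

lemma dis_induced_mono: "S \<subseteq> T \<Longrightarrow> dis (induced G S) v \<subseteq> dis (induced G T) v"
proof -
  assume "S \<subseteq> T"
  then have "bidir (induced G S) \<subseteq> bidir (induced G T)" by (auto simp: induced_def)
  from rtrancl_mono[OF this] show ?thesis by (auto simp: dis_def)
qed

lemma dis_induced_subset: "v \<in> S \<Longrightarrow> dis (induced G S) v \<subseteq> S"
proof
  fix u assume "v \<in> S" "u \<in> dis (induced G S) v"
  then show "u \<in> S"
    by (auto simp: dis_def induced_def elim: converse_rtranclE)
qed

lemma pa_set_induced: "pa_set (induced G S) D = {u \<in> S. \<exists>w \<in> D \<inter> S. (u, w) \<in> dir G}"
  by (auto simp: pa_set_def pa_def induced_def)

text \<open>Two vertices are adjacent in the augmented (moralised) graph iff they share a cluster of \<open>induced G S\<close>.\<close>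

definition cluster :: "'a mixed_graph \<Rightarrow> 'a set \<Rightarrow> 'a \<Rightarrow> 'a set" where
  "cluster G S v = dis (induced G S) v \<union> pa_set (induced G S) (dis (induced G S) v)"

lemma cluster_mono: "S \<subseteq> T \<Longrightarrow> cluster G S v \<subseteq> cluster G T v"
  using dis_induced_mono[of S T G v] unfolding cluster_def pa_set_induced by blast

lemma cluster_subset: "v \<in> S \<Longrightarrow> cluster G S v \<subseteq> S"
  using dis_induced_subset[of v S G] unfolding cluster_def pa_set_induced by blast

text \<open>A vertex without children in \<open>S\<close> lies in no cluster but that of its own
  district, so its Markov blanket is its neighbourhood in the augmented graph. This links the local
  property to the separation condition on clusters.\<close>

lemma cluster_eq_mb: "cluster G S v = insert v (mb G v S)"
  using dis_refl[of v "induced G S"] unfolding cluster_def mb_def by blast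

lemma sink_notin_mb:
  assumes "\<And>w. w \<in> S \<Longrightarrow> (v, w) \<notin> dir G"
  shows "v \<notin> mb G v S"
  using assms unfolding mb_def pa_set_induced by blast

text \<open>Consistency excludes a child strictly before \<open>v\<close>; acyclicity excludes a
  loop at \<open>v\<close>, which itself belongs to \<open>pre r v\<close>.\<close>

lemma no_child_in_pre:
  assumes "admg G" "consistent_ordering G r" "w \<in> pre r v"
  shows "(v, w) \<notin> dir G"
proof
  assume vw: "(v, w) \<in> dir G"
  then have "v \<in> an G w" by (auto simp: an_def)
  then have "w = v" using assms unfolding consistent_ordering_def pre_def by blast
  with vw assms(1) show False by (auto simp: admg_def acyclic_def)
qed

lemma pre_subset: "consistent_ordering G r \<Longrightarrow> x \<in> verts G \<Longrightarrow> pre r x \<subseteq> verts G"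
  by (auto simp: consistent_ordering_def pre_def)

lemma ex_last:
  assumes "consistent_ordering G r" "S \<subseteq> verts G" "finite S" "S \<noteq> {}"
  obtains v where "v \<in> S" "S \<subseteq> pre r v"
proof -
  have tr: "trans r" "total_on (verts G) r"
    using assms(1) by (auto simp: consistent_ordering_def strict_linear_order_on_def)
  have "\<exists>v\<in>S. S \<subseteq> pre r v"
    using assms(3,4,2)
  proof (induction rule: finite_ne_induct)
    case (singleton a)
    then show ?case by (auto simp: pre_def)
  next
    case (insert a F)
    from insert.prems have "F \<subseteq> verts G" by simp
    from insert.IH[OF this] obtain v where v: "v \<in> F" "F \<subseteq> pre r v" ..
    have "a \<noteq> v" "a \<in> verts G" "v \<in> verts G" using v(1) insert.hyps insert.prems by auto
    then have "(a, v) \<in> r \<or> (v, a) \<in> r" using tr(2) by (simp add: total_on_def)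
    then show ?case
    proof
      assume "(a, v) \<in> r"
      then show ?thesis using v by (auto simp: pre_def)
    next
      assume "(v, a) \<in> r"
      then have "insert a F \<subseteq> pre r a" using v(2) transD[OF tr(1), of _ v a] unfolding pre_def by blast
      then show ?thesis by blast
    qed
  qed
  then show thesis using that by blast
qed

lemma ancestral_Diff_last:
  assumes "admg G" "consistent_ordering G r" "ancestral G S" "S \<subseteq> pre r v"
  shows "ancestral G (S - {v})"
  using assms no_child_in_pre[OF assms(1,2), of _ v] unfolding ancestral_iff by blast

text \<open>The ordered local property is assumed for maximal sets alone. Enlarging \<open>S\<close>
  without changing its blanket carries it over, by decomposition, to every ancestral
  \<open>S\<close> with last vertex \<open>v\<close>.\<close>

lemma ex_maximal_ancestral:
  assumes "admg G" "consistent_ordering G r" "ancestral G S" "v \<in> S" "S \<subseteq> pre r v"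
  obtains T where "maximal_ancestral G r v T" "S \<subseteq> T" "mb G v T = mb G v S"
proof -
  \<comment> \<open>All candidates share one blanket, so an inclusion-maximal member of this finite
    family is maximal in the sense of \<open>maximal_ancestral\<close>.\<close>
  let ?C = "{B. ancestral G B \<and> B \<subseteq> pre r v \<and> mb G v B = mb G v S \<and> S \<subseteq> B}"
  have "?C \<subseteq> Pow (verts G)" by (auto simp: ancestral_iff)
  moreover have "finite (verts G)" using assms(1) by (simp add: admg_def)
  ultimately have fin: "finite ?C" using finite_subset by blast
  have S: "S \<in> ?C" using assms by simp
  obtain T where T: "T \<in> ?C" and max: "\<forall>B\<in>?C. T \<subseteq> B \<longrightarrow> T = B"
    using finite_has_maximal2[OF fin S] by (elim bexE conjE)
  have "maximal_ancestral G r v T"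
    unfolding maximal_ancestral_def
  proof (intro conjI allI impI)
    fix B assume B: "ancestral G B \<and> T \<subseteq> B \<and> B \<subseteq> pre r v \<and> mb G v T = mb G v B"
    then have "B \<in> ?C" using T by auto
    then show "T = B" using B max by simp
  qed (use T assms(4) in auto)
  with T show thesis by (intro that[of T]) auto
qed

section \<open>From the ordered local to the global Markov property\<close>

text \<open>Clusters shrink when the last vertex \<open>v\<close> is removed, so the induction
  hypothesis covers the rest. The cluster of \<open>v\<close> misses \<open>X\<close> or
  \<open>Y\<close>, and the local property at \<open>v\<close> then lets \<open>v\<close> be put
  back. The set \<open>U\<close> restricts the local property to the vertices for which it is
  available.\<close>

lemma (in coordinate_process) cond_indep_of_clusters:
  assumes G: "admg G" "consistent_ordering G r" and V: "V = verts G"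
    and local: "\<And>v S. v \<in> U \<Longrightarrow> ancestral G S \<Longrightarrow> v \<in> S \<Longrightarrow> S \<subseteq> pre r v \<Longrightarrow>
      indep_given {v} (mb G v S) (S - (mb G v S \<union> {v}))"
    and "ancestral G (X \<union> Z \<union> Y)" "X \<union> Z \<union> Y \<subseteq> U"
    and "X \<inter> Z = {}" "X \<inter> Y = {}" "Z \<inter> Y = {}"
    and "\<And>v. v \<in> X \<union> Z \<union> Y \<Longrightarrow>
      cluster G (X \<union> Z \<union> Y) v \<inter> X = {} \<or> cluster G (X \<union> Z \<union> Y) v \<inter> Y = {}"
  shows "indep_given X Z Y"
proof -
  have "X \<union> Z \<union> Y \<subseteq> verts G" using assms(5) by (simp add: ancestral_iff)
  moreover have "finite (verts G)" using G by (simp add: admg_def)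
  ultimately have "finite (X \<union> Z \<union> Y)" by (rule finite_subset)
  from this assms(5-) show ?thesis
  proof (induction "X \<union> Z \<union> Y" arbitrary: X Z Y rule: finite_psubset_induct)
    case psubset
    define S where "S = X \<union> Z \<union> Y"
    have S_sub: "S \<subseteq> V" using psubset.prems(1) unfolding S_def V by (simp add: ancestral_iff)
    show ?case
    proof (cases "S = {}")
      case True
      then show ?thesis by (simp add: S_def cond_indep_iff)
    next
      case False
      obtain v where v: "v \<in> S" "S \<subseteq> pre r v"
        using ex_last[OF G(2) S_sub[unfolded V] _ False] psubset.hyps(1) unfolding S_def by blast
      have anc: "ancestral G S" using psubset.prems(1) by (simp add: S_def)
      \<comment> \<open>By disjointness \<open>v\<close> lies in only one of the three sets;
        deleting it from each avoids a case split here.\<close>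
      have IH: "indep_given (X - {v}) (Z - {v}) (Y - {v})"
      proof (rule psubset.hyps(2))
        have eq: "X - {v} \<union> (Z - {v}) \<union> (Y - {v}) = S - {v}" by (auto simp: S_def)
        show "X - {v} \<union> (Z - {v}) \<union> (Y - {v}) \<subset> X \<union> Z \<union> Y"
          using v(1) unfolding S_def by blast
        show "ancestral G (X - {v} \<union> (Z - {v}) \<union> (Y - {v}))"
          unfolding eq by (rule ancestral_Diff_last[OF G anc v(2)])
        show "cluster G (X - {v} \<union> (Z - {v}) \<union> (Y - {v})) w \<inter> (X - {v}) = {} \<or>
              cluster G (X - {v} \<union> (Z - {v}) \<union> (Y - {v})) w \<inter> (Y - {v}) = {}"
          if "w \<in> X - {v} \<union> (Z - {v}) \<union> (Y - {v})" for w
        proof -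
          have "cluster G S w \<inter> X = {} \<or> cluster G S w \<inter> Y = {}"
            using psubset.prems(6)[of w] that by (auto simp: S_def)
          moreover have "cluster G (S - {v}) w \<subseteq> cluster G S w"
            by (rule cluster_mono) blast
          ultimately show ?thesis unfolding eq by blast
        qed
      qed (use psubset.prems(2-5) in auto)
      have v_mb: "v \<notin> mb G v S"
        using v(2) by (intro sink_notin_mb no_child_in_pre[OF G]) blast
      \<comment> \<open>Reinsertion of \<open>v\<close> on the side away from \<open>Y'\<close>. It
        is stated for arbitrary \<open>X'\<close> and \<open>Y'\<close> because it is applied both
        to \<open>X\<close>, \<open>Y\<close> and to the swapped pair.\<close>
      have step: "indep_given X' Z Y'"
        if I: "indep_given (X' - {v}) (Z - {v}) Y'"
          and C: "cluster G S v \<inter> Y' = {}" and dec: "S = X' \<union> Z \<union> Y'"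
          and disj: "X' \<inter> Z = {}" "X' \<inter> Y' = {}" "Z \<inter> Y' = {}" for X' Y'
      proof -
        let ?m = "mb G v S" and ?W = "X' - {v} \<union> (Z - {v})"
        have vY: "v \<notin> Y'" using C by (auto simp: cluster_eq_mb)
        have m: "?m \<subseteq> ?W" "?m \<inter> Y' = {}"
          using C v_mb cluster_subset[OF v(1), of G] unfolding cluster_eq_mb dec by auto
        have sub: "X' \<subseteq> V" "Y' \<subseteq> V" "Z \<subseteq> V" "v \<in> V" "X' - {v} \<subseteq> V" "Z - {v} \<subseteq> V" "{v} \<subseteq> V"
          "?W - ?m \<subseteq> V" "?m \<subseteq> V"
          using S_sub v(1) m unfolding dec by auto
        have "v \<in> U" using psubset.prems(2) v(1) by (auto simp: S_def)
        moreover have "S - (?m \<union> {v}) = Y' \<union> (?W - ?m)"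
          using m vY disj unfolding dec by auto
        \<comment> \<open>The blanket lies in \<open>?W\<close>, as the cluster of \<open>v\<close>
          misses \<open>Y'\<close>. Weak union therefore enlarges the conditioning set from
          \<open>?m\<close> to all of \<open>?W\<close>, leaving \<open>Y'\<close> as the other
          side.\<close>
        ultimately have "indep_given {v} ?m (Y' \<union> (?W - ?m))"
          using local[OF _ anc v] by simp
        from cond_indep_weak_union[OF this]
        have "indep_given {v} (?m \<union> (?W - ?m)) Y'" using sub by blast
        moreover have "?m \<union> (?W - ?m) = (Z - {v}) \<union> (X' - {v})" using m(1) by blast
        ultimately have "indep_given Y' ((Z - {v}) \<union> (X' - {v})) {v}"
          by (simp add: cond_indep_sym)
        from cond_indep_contraction[OF cond_indep_sym[OF I] this]
        \<comment> \<open>If \<open>v \<in> X'\<close> this is already the goal up to symmetry; if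
          \<open>v \<in> Z\<close>, weak union moves \<open>v\<close> into the conditioning
          set.\<close>
        have *: "indep_given Y' (Z - {v}) (X' - {v} \<union> {v})" using sub by blast
        consider "v \<in> X'" | "v \<in> Z" using v(1) vY unfolding dec by blast
        then show ?thesis
        proof cases
          case 1
          then have "Z - {v} = Z" "X' - {v} \<union> {v} = X'" using disj by auto
          then show ?thesis using * cond_indep_sym by metis
        next
          case 2
          then have "(Z - {v}) \<union> {v} = Z" "X' - {v} = X'" using disj by auto
          then show ?thesis
            using cond_indep_sym[OF cond_indep_weak_union[OF *]] sub by auto
        qed
      qed
      consider "cluster G S v \<inter> X = {}" | "cluster G S v \<inter> Y = {}"
        using psubset.prems(6) v(1) unfolding S_def by blast
      then show ?thesis
      proof cases
        case 1
        then have "v \<notin> X" by (auto simp: cluster_eq_mb)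
        then have "indep_given (Y - {v}) (Z - {v}) X" using cond_indep_sym[OF IH] by simp
        then have "indep_given Y Z X"
          by (rule step) (use 1 psubset.prems(3-5) in \<open>auto simp: S_def\<close>)
        then show ?thesis by (rule cond_indep_sym)
      next
        case 2
        then have "v \<notin> Y" by (auto simp: cluster_eq_mb)
        then have "indep_given (X - {v}) (Z - {v}) Y" using IH by simp
        then show ?thesis
          by (rule step) (use 2 psubset.prems(3-5) in \<open>auto simp: S_def\<close>)
      qed
    qed
  qed
qed

section \<open>Passage from the full predecessor set to a maximal ancestral subset\<close>

theorem lemma2:
  fixes G :: "'a mixed_graph" and r :: "('a \<times> 'a) set" and x :: 'a
    and P :: "('a \<Rightarrow> 'b) measure" and M :: "'a \<Rightarrow> 'b measure"
    and A A' Y Y1 Y2 :: "'a set"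
  assumes "admg G"
    and "consistent_ordering G r"
    and "x \<in> verts G"
    and "prob_space P"
    and "sets P = sets (Pi\<^sub>M (verts G) M)"
    and "\<And>y S. y \<in> pre r x - {x} \<Longrightarrow> maximal_ancestral G r y S \<Longrightarrow>
           cond_indep P M {y} (mb G y S) (S - (mb G y S \<union> {y}))"
    and "A = pre r x"
    and "maximal_ancestral G r x A'"
    and "Y = dis (induced G A) x - dis (induced G A') x"
    and "Y1 = dis (induced G A) x - (A' \<inter> dis (induced G A) x)"
    and "Y2 = Y - Y1"
    and "Y2 = {}"
    and "pa_set G Y \<subseteq> mb G x A'"
    and "cond_indep P M {x} (mb G x A) (A - (mb G x A \<union> {x}))"
  shows "cond_indep P M {x} (mb G x A') (A' - (mb G x A' \<union> {x}))"
proof -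
  interpret prob_space P by (rule assms(4))
  interpret coordinate_process P "verts G" M by standard (rule assms(5))
  note G = assms(1,2)
  define D D' B where "D = dis (induced G A) x" and "D' = dis (induced G A') x" and "B = mb G x A'"
  define C where "C = A' - (B \<union> {x})"
  have A': "ancestral G A'" "x \<in> A'" "A' \<subseteq> A"
    using assms(7,8) by (auto simp: maximal_ancestral_def)
  have A_sub: "A \<subseteq> verts G" using pre_subset[OF assms(2,3)] assms(7) by simp
  have x_A: "x \<in> A" using assms(7) by (simp add: pre_def)
  have D_sub: "D \<subseteq> A" "D' \<subseteq> A'"
    using dis_induced_subset[OF x_A, of G] dis_induced_subset[OF A'(2), of G]
    by (simp_all add: D_def D'_def)
  have "D' \<subseteq> D" unfolding D_def D'_def by (rule dis_induced_mono[OF A'(3)])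
  \<comment> \<open>\<open>Y2 = {}\<close> means \<open>Y \<subseteq> Y1\<close>, and
    \<open>Y1\<close> is the part of \<open>D\<close> outside \<open>A'\<close>.\<close>
  have Y: "Y = D - D'" "Y \<inter> A' = {}"
    using assms(9-12) by (auto simp: D_def D'_def)
  have D_eq: "D = D' \<union> Y" using Y(1) \<open>D' \<subseteq> D\<close> by blast
  have x_D': "x \<in> D'" by (simp add: D'_def)
  have no_child: "(x, w) \<notin> dir G" if "w \<in> A" for w
    using no_child_in_pre[OF G] that assms(7) by blast
  have x_B: "x \<notin> B" unfolding B_def using A'(3) by (intro sink_notin_mb no_child) blast
  have B_eq: "insert x B = D' \<union> pa_set (induced G A') D'"
    using cluster_eq_mb[of G A' x] unfolding cluster_def B_def D'_def by simp
  have B_sub: "B \<subseteq> A'"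
    using B_eq D_sub(2) unfolding pa_set_induced by blast
  have paY: "v \<in> B" if "(v, w) \<in> dir G" "w \<in> Y" for v w
    using assms(13) that by (auto simp: pa_set_def pa_def B_def)
  \<comment> \<open>Since \<open>A'\<close> is ancestral, parents in \<open>G\<close> of
    \<open>D'\<close> are already parents in the induced graph; \<open>x\<close> is not among them
    because it has no child in \<open>A\<close>.\<close>
  have paD': "v \<in> B" if "(v, w) \<in> dir G" "w \<in> D'" for v w
  proof -
    have w: "w \<in> A'" using that D_sub by blast
    have "v \<in> A'" using that w A'(1) by (auto simp: ancestral_iff)
    then have "v \<in> insert x B" using that w unfolding B_eq pa_set_induced by blast
    moreover have "v \<noteq> x" using no_child that w A'(3) by blast
    ultimately show ?thesis by blast
  qed
  \<comment> \<open>Passing from \<open>A'\<close> to \<open>A\<close> enlarges the district by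
    \<open>Y\<close>, and by \<open>paY\<close> the parents of \<open>Y\<close> contribute nothing
    outside \<open>B\<close>.\<close>
  have mb_A: "mb G x A = B \<union> Y"
  proof -
    have "mb G x A = pa_set (induced G A) D \<union> (D - {x})" by (simp add: mb_def D_def)
    also have "\<dots> = B \<union> Y"
    proof
      show "pa_set (induced G A) D \<union> (D - {x}) \<subseteq> B \<union> Y"
        using paY paD' B_eq unfolding pa_set_induced D_eq by blast
      have "pa_set (induced G A') D' \<subseteq> pa_set (induced G A) D"
        using \<open>D' \<subseteq> D\<close> A'(3) unfolding pa_set_induced by blast
      then show "B \<union> Y \<subseteq> pa_set (induced G A) D \<union> (D - {x})"
        using B_eq x_B x_D' D_eq Y by blast
    qed
    finally show ?thesis .
  qed
  have local: "indep_given {v} (mb G v S) (S - (mb G v S \<union> {v}))"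
    if v: "v \<in> pre r x - {x}" and S: "ancestral G S" "v \<in> S" "S \<subseteq> pre r v" for v S
  proof -
    obtain T where T: "maximal_ancestral G r v T" "S \<subseteq> T" "mb G v T = mb G v S"
      using ex_maximal_ancestral[OF G S] .
    have "T \<subseteq> verts G" using T(1) by (auto simp: maximal_ancestral_def ancestral_iff)
    from cond_indep_mono[OF assms(6)[OF v T(1)], of "{v}" "S - (mb G v S \<union> {v})"]
    show ?thesis using T S \<open>T \<subseteq> verts G\<close> by auto
  qed
  have Y_B_C: "indep_given Y B C"
  proof (rule cond_indep_of_clusters[OF G refl local])
    let ?S = "Y \<union> B \<union> C"
    \<comment> \<open>With \<open>x\<close> absent, every vertex of \<open>?S\<close> strictly
      precedes \<open>x\<close>, which is where the local property is assumed.\<close>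
    have S_eq: "?S = Y \<union> (A' - {x})" using x_B B_sub by (auto simp: C_def)
    have S_A: "?S \<subseteq> A" using S_eq D_sub D_eq A'(3) by blast
    have x_Y: "x \<notin> Y" using Y x_D' by blast
    show "ancestral G ?S"
      unfolding ancestral_iff
    proof (intro conjI allI impI)
      show "?S \<subseteq> verts G" using S_A A_sub by blast
      fix v w assume vw: "(v, w) \<in> dir G" and w: "w \<in> ?S"
      have "v \<noteq> x" using no_child vw w S_A by blast
      moreover have "v \<in> A'" if "w \<in> A'" using that vw A'(1) by (auto simp: ancestral_iff)
      ultimately show "v \<in> ?S" using paY[OF vw] w unfolding S_eq using B_sub by blast
    qed
    show "?S \<subseteq> pre r x - {x}" using S_A S_eq x_Y assms(7) by blast
    show "Y \<inter> B = {}" "Y \<inter> C = {}" "B \<inter> C = {}"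
      using Y(2) B_sub by (auto simp: C_def)
    fix v assume v: "v \<in> ?S"
    show "cluster G ?S v \<inter> Y = {} \<or> cluster G ?S v \<inter> C = {}"
    proof (rule disjCI)
      assume "cluster G ?S v \<inter> C \<noteq> {}"
      show "cluster G ?S v \<inter> Y = {}"
      proof (rule ccontr)
        assume "cluster G ?S v \<inter> Y \<noteq> {}"
        then obtain y where y: "y \<in> cluster G ?S v" "y \<in> Y" by blast
        have sym: "sym (bidir (induced G T))" for T
          using G(1) by (auto simp: admg_def induced_def sym_def)
        \<comment> \<open>A child of \<open>y\<close> in \<open>Y\<close> would put \<open>y\<close>
          into \<open>B\<close>, a child in \<open>A'\<close> would put it into \<open>A'\<close>;
          both contradict \<open>Y \<inter> A' = {}\<close>. So \<open>y\<close> can enter the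
          cluster only through the district.\<close>
        have "(y, w) \<notin> dir G" if "w \<in> ?S" for w
        proof
          assume yw: "(y, w) \<in> dir G"
          then have "w \<notin> Y" using paY y(2) Y(2) B_sub by blast
          then have "w \<in> A'" using that S_eq by blast
          then have "y \<in> A'" using yw A'(1) by (auto simp: ancestral_iff)
          then show False using y(2) Y(2) by blast
        qed
        then have y_dis: "y \<in> dis (induced G ?S) v"
          using y(1) unfolding cluster_def pa_set_induced by blast
        \<comment> \<open>This district lies inside the district \<open>D\<close> of
          \<open>x\<close> in \<open>A\<close>, without \<open>x\<close>. Its members and their
          parents therefore stay in \<open>B \<union> Y\<close>, which misses
          \<open>C\<close>.\<close>
        have "dis (induced G ?S) v = dis (induced G ?S) y"
          using dis_eq[OF sym y_dis] by simp
        also have "\<dots> \<subseteq> dis (induced G A) y" by (rule dis_induced_mono[OF S_A])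
        also have "\<dots> = D"
          using dis_eq[OF sym, of y A x] y(2) Y(1) by (auto simp: D_def)
        finally have "dis (induced G ?S) v \<subseteq> (D' - {x}) \<union> Y"
          using dis_induced_subset[OF v, of G] x_Y S_eq D_eq by blast
        then have "cluster G ?S v \<subseteq> B \<union> Y"
          using paY paD' B_eq unfolding cluster_def pa_set_induced by blast
        then have "cluster G ?S v \<inter> C = {}" using Y(2) by (auto simp: C_def)
        then show False using \<open>cluster G ?S v \<inter> C \<noteq> {}\<close> by blast
      qed
    qed
  qed
  have sub: "B \<subseteq> verts G" "Y \<subseteq> verts G" "C \<subseteq> verts G" "{x} \<subseteq> verts G"
    using B_sub A'(3) A_sub assms(3) D_eq D_sub by (auto simp: C_def)
  have "indep_given {x} (B \<union> Y) (A - (B \<union> Y \<union> {x}))" using assms(14) by (simp add: mb_A)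
  then have "indep_given {x} (B \<union> Y) C"
    by (rule cond_indep_mono) (use A_sub A'(3) Y(2) sub in \<open>auto simp: C_def\<close>)
  \<comment> \<open>Contraction is applied from the side of \<open>C\<close>, where \<open>Y\<close>
    and then \<open>x\<close> are added; decomposition afterwards discards \<open>Y\<close>.\<close>
  from cond_indep_contraction[OF cond_indep_sym[OF Y_B_C] cond_indep_sym[OF this]]
  have "indep_given C B (Y \<union> {x})" using sub by blast
  then have "indep_given C B {x}"
    by (rule cond_indep_mono) (use sub in auto)
  then show ?thesis
    unfolding C_def B_def by (rule cond_indep_sym)
qed

end
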